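(* Let $r\geqslant1$ be an integer and consider a set of $r$ non-degenerate probability distributions on the real line. Let $\{\eta_k\}_{k=0}^\infty$ be a sequence of independent real-valued random variables (not necessarily identically distributed) each of whose distributions belongs to this set. Put $g_n(x)=\sum_{k=0}^n\eta_kx^k$ and let $M_n$ denote the number of real roots of the polynomial $g_n(x)$. Then $$\mathbf{P}\left\{\frac{M_n}{n}\underset{n\to\infty}{\longrightarrow}0\right\}=1\quad\text{and}\quad \mathbf{E}M_n=o(n),\quad n\to\infty.$$
   Context: A probability distribution is non-degenerate if it is not concentrated at a single point. Real roots are counted with multiplicity. On the event that $g_n$ is identically zero put $M_n=0$. *)

theory Defs
  imports "HOL-Probability.Probability" "HOL-Computational_Algebra.Computational_Algebra"
begin

definition nondegenerate :: "real measure \<Rightarrow> bool" where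
  "nondegenerate \<mu> \<longleftrightarrow> \<not> (\<exists>a. measure \<mu> {a} = 1)"

definition rand_poly :: "(nat \<Rightarrow> 'a \<Rightarrow> real) \<Rightarrow> nat \<Rightarrow> 'a \<Rightarrow> real poly" where
  "rand_poly \<eta> n \<omega> = (\<Sum>k\<le>n. monom (\<eta> k \<omega>) k)"

(* proots is a multiset, so roots are counted with multiplicity. *)
definition num_real_roots :: "real poly \<Rightarrow> nat" where
  "num_real_roots p = (if p = 0 then 0 else size (proots p))"

end

theory Submission
  imports Defs "HOL-Real_Asymp.Real_Asymp"
begin

text \<open>
  Multiplying a polynomial by \<open>1 + x + \<dots> + x^m\<close> does not lose positive roots and replaces its
  coefficients by sums over windows of length \<open>m + 1\<close>. By Descartes' rule of signs the number of
  positive roots is thus at most \<open>2 m\<close> plus the number of places where consecutive window sums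
  fail to have the same strict sign. Consecutive window sums differ by two coefficients only,
  while a sum of \<open>m + 1\<close> independent variables, with non-degenerate laws taken from a finite set, lies
  in a given bounded interval with a probability that tends to 0 as \<open>m\<close> grows. So such a place is
  unlikely for large \<open>m\<close>; windows far enough apart being independent, Hoeffding's inequality and
  Borel-Cantelli bound the number of these places almost surely by an arbitrarily small multiple
  of \<open>n\<close>. Negative roots are treated with the coefficients \<open>(-1)^k \<eta>\<^sub>k\<close>, and the root 0 has bounded
  multiplicity. The statement on expectations follows by dominated convergence.
\<close>

subsection \<open>Descartes' rule of signs\<close>

text \<open>Encodes "at least \<open>k\<close> sign changes" without deleting zeros: a chain of
  \<open>k + 1\<close> indices ending at \<open>i\<close> along which the signs alternate. Recording
  the last index lets a chain be prolonged to the right.\<close>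

inductive alternation :: "(nat \<Rightarrow> real) \<Rightarrow> nat \<Rightarrow> nat \<Rightarrow> bool" for c where
  start: "c i \<noteq> 0 \<Longrightarrow> alternation c 0 i"
| step: "alternation c k i \<Longrightarrow> i < j \<Longrightarrow> c i * c j < 0 \<Longrightarrow> alternation c (Suc k) j"

lemma alternation_nonzero: "alternation c k i \<Longrightarrow> c i \<noteq> 0"
  by (induction rule: alternation.induct) auto

text \<open>A vanishing product counts as a break. This only weakens the bound on roots and spares a
  separate treatment of zero entries.\<close>

definition breaks :: "(nat \<Rightarrow> real) \<Rightarrow> nat \<Rightarrow> nat set" where
  "breaks c n = {j. j < n \<and> \<not> c j * c (Suc j) > 0}"

lemma finite_breaks [simp]: "finite (breaks c n)"
  by (simp add: breaks_def)

text \<open>Each link of the chain from \<open>i\<close> to \<open>j\<close> forces a break in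
  \<open>{i..<j}\<close>; these ranges are disjoint, so no break is counted twice.\<close>

lemma alternation_le_card_breaks: "alternation c k i \<Longrightarrow> k \<le> card (breaks c i)"
proof (induction rule: alternation.induct)
  case (step k i j)
  have "\<exists>l. i \<le> l \<and> l < j \<and> \<not> c l * c (Suc l) > 0"
  proof (rule ccontr)
    assume *: "\<nexists>l. i \<le> l \<and> l < j \<and> \<not> c l * c (Suc l) > 0"
    \<comment> \<open>Without a break the sign of \<open>c i\<close> propagates up to
      \<open>c j\<close>.\<close>
    have "l \<le> j \<longrightarrow> c i * c l > 0" if "i \<le> l" for l
      using that
    proof (induction l rule: dec_induct)
      case base
      then show ?case using alternation_nonzero[OF step.hyps(1)] by (simp add: zero_less_mult_iff) linarith
    next
      case (step l)
      have "c l * c (Suc l) > 0" if "Suc l \<le> j" using * step that by auto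
      then show ?case using step by (auto simp: zero_less_mult_iff)
    qed
    from this[of j] step show False by auto
  qed
  then obtain l where l: "i \<le> l" "l < j" "\<not> c l * c (Suc l) > 0" by blast
  have "card (insert l (breaks c i)) \<le> card (breaks c j)"
    using l by (intro card_mono) (auto simp: breaks_def)
  also have "card (insert l (breaks c i)) = Suc (card (breaks c i))"
    using l by (subst card_insert_disjoint) (auto simp: breaks_def)
  finally show ?case using step.IH by simp
qed simp

lemma sum_neg_imp_ex_neg:
  fixes f :: "nat \<Rightarrow> real"
  assumes "sum f A < 0"
  shows "\<exists>l\<in>A. f l < 0"
  using assms by (meson not_less sum_nonneg)

text \<open>Up to a positive factor the coefficients of \<open>q\<close> are, with the opposite sign, the partial
  sums of the sequence \<open>coeff p l * a ^ l\<close>, whose total sum is \<open>poly p a = 0\<close>; every change of sign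
  of the partial sums, including those at both ends, is caused by a term of the right sign.\<close>

lemma alternation_linear_factor:
  fixes a :: real and q :: "real poly"
  defines "p \<equiv> [:-a, 1:] * q"
  assumes "a > 0" and "alternation (coeff q) k i"
  shows "\<exists>j. alternation (coeff p) (Suc k) j"
proof -
  \<comment> \<open>\<open>Q (Suc j)\<close> has the sign of \<open>coeff q j\<close>, and the
    scaling by powers of \<open>a\<close> turns the two-term formula for the coefficients of
    \<open>p\<close> into a telescoping difference.\<close>
  define Q where "Q = (\<lambda>j. case j of 0 \<Rightarrow> 0 | Suc j \<Rightarrow> a ^ Suc j * coeff q j)"
  have Q_Suc: "Q (Suc j) = a ^ Suc j * coeff q j" for j by (simp add: Q_def)
  have p: "coeff p j * a ^ j = Q j - Q (Suc j)" for j
    by (cases j) (simp_all add: p_def Q_def algebra_simps)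
  have tele: "(\<Sum>l\<in>{i..<j}. coeff p l * a ^ l) = Q i - Q j" if "i \<le> j" for i j
    using that by (induction j rule: dec_induct) (simp_all add: p)
  have ex: "\<exists>l\<in>{i..<j}. coeff p l * s < 0" if "i \<le> j" "(Q i - Q j) * s < 0" for i j s
  proof -
    have "(\<Sum>l\<in>{i..<j}. coeff p l * a ^ l * s) < 0"
      using that by (simp add: tele sum_distrib_right[symmetric])
    then obtain l where "l\<in>{i..<j}" "coeff p l * a ^ l * s < 0"
      using sum_neg_imp_ex_neg by blast
    moreover have "coeff p l * a ^ l * s = a ^ l * (coeff p l * s)" by simp
    ultimately show ?thesis using \<open>a > 0\<close> by (metis mult_less_0_iff zero_less_power order.asym)
  qed
  \<comment> \<open>The induction also keeps the chain for \<open>p\<close> at or before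
    \<open>i\<close>, with last sign opposite to that of \<open>coeff q i\<close>; the next index
    can then be sought strictly after \<open>i\<close>.\<close>
  have "\<exists>j\<le>i. alternation (coeff p) k j \<and> coeff p j * coeff q i < 0"
    using assms(3)
  proof (induction rule: alternation.induct)
    case (start i)
    have "(Q 0 - Q (Suc i)) * coeff q i = - (a ^ Suc i * (coeff q i)\<^sup>2)"
      by (simp add: Q_def power2_eq_square)
    also have "\<dots> < 0" using start \<open>a > 0\<close> by (simp add: zero_less_mult_iff)
    finally obtain l where "l < Suc i" "coeff p l * coeff q i < 0"
      using ex[of 0 "Suc i" "coeff q i"] by auto
    then show ?case
      by (intro exI[of _ l]) (auto intro: alternation.start)
  next
    case (step k i j)
    then obtain i' where i': "i' \<le> i" "alternation (coeff p) k i'" "coeff p i' * coeff q i < 0" by blast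
    have "Q (Suc i) * coeff q j < 0"
      using step \<open>a > 0\<close> by (simp add: Q_Suc mult_less_0_iff zero_less_mult_iff)
    moreover have "Q (Suc j) * coeff q j \<ge> 0"
      using \<open>a > 0\<close> by (simp add: Q_Suc mult.assoc)
    ultimately have "(Q (Suc i) - Q (Suc j)) * coeff q j < 0" by (simp add: algebra_simps)
    then obtain l where l: "Suc i \<le> l" "l < Suc j" "coeff p l * coeff q j < 0"
      using ex[of "Suc i" "Suc j" "coeff q j"] step by auto
    then have "coeff p i' * coeff p l < 0"
      using i' step by (auto simp: mult_less_0_iff)
    with l i' show ?case
      by (intro exI[of _ l]) (auto intro: alternation.step[of _ _ i'])
  qed
  then obtain j where j: "j \<le> i" "alternation (coeff p) k j" "coeff p j * coeff q i < 0" by blast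
  \<comment> \<open>\<open>Q\<close> vanishes past the degree of \<open>q\<close>, so its return
    from \<open>Q (Suc i)\<close> to 0 supplies the one extra sign change.\<close>
  define d where "d = Suc (Suc (degree q))"
  have "i \<le> degree q" using j by (intro le_degree) auto
  have "Q d = 0" by (simp add: d_def Q_Suc coeff_eq_0)
  then have "(Q (Suc i) - Q d) * - coeff q i = - (a ^ Suc i * (coeff q i)\<^sup>2)"
    by (simp add: Q_def power2_eq_square)
  also have "\<dots> < 0" using j(3) \<open>a > 0\<close> by (auto simp: zero_less_mult_iff)
  finally obtain l where l: "Suc i \<le> l" "coeff p l * - coeff q i < 0"
    using ex[of "Suc i" d "- coeff q i"] \<open>i \<le> degree q\<close> by (auto simp: d_def)
  then have "coeff p j * coeff p l < 0"
    using j by (auto simp: mult_less_0_iff zero_less_mult_iff)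
  then show ?thesis using j l by (intro exI[of _ l] alternation.step[of _ _ j]) auto
qed

abbreviation positive_roots :: "real poly \<Rightarrow> real multiset" where
  "positive_roots p \<equiv> filter_mset (\<lambda>x. x > 0) (proots p)"

text \<open>Positive roots are split off one at a time, each linear factor adding one sign change.
  Once none is left, the nonzero leading coefficient starts the chain.\<close>

lemma exists_alternation:
  assumes "p \<noteq> 0"
  shows "\<exists>i. alternation (coeff p) (size (positive_roots p)) i"
  using assms
proof (induction "size (positive_roots p)" arbitrary: p)
  case 0
  then have "alternation (coeff p) 0 (degree p)" by (intro alternation.start) simp
  with 0(1) show ?case by metis
next
  case (Suc k)
  then obtain a where a: "a \<in># positive_roots p"
    by (metis size_eq_Suc_imp_elem)
  then have "a > 0" "poly p a = 0" using Suc by auto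
  then obtain q where q: "p = [:-a, 1:] * q" by (metis poly_eq_0_iff_dvd dvdE)
  have "q \<noteq> 0" using q Suc by auto
  then have "proots p = {#a#} + proots q"
    unfolding q by (subst proots_mult) auto
  then have sz: "size (positive_roots p) = Suc (size (positive_roots q))" using \<open>a > 0\<close> by simp
  then obtain i where "alternation (coeff q) (size (positive_roots q)) i"
    using Suc \<open>q \<noteq> 0\<close> by (metis Suc_inject)
  from alternation_linear_factor[OF \<open>a > 0\<close> this] show ?case unfolding sz by (simp only: q)
qed

lemma Descartes_bound:
  assumes "p \<noteq> 0" "degree p \<le> n"
  shows "size (positive_roots p) \<le> card (breaks (coeff p) n)"
proof -
  obtain i where i: "alternation (coeff p) (size (positive_roots p)) i"
    using exists_alternation assms by blast
  have "i \<le> n" using alternation_nonzero[OF i] le_degree[of p i] assms(2) by linarith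
  then have "card (breaks (coeff p) i) \<le> card (breaks (coeff p) n)"
    by (intro card_mono) (auto simp: breaks_def)
  then show ?thesis using alternation_le_card_breaks[OF i] by simp
qed

section \<open>Window sums and positive roots\<close>

definition window :: "(nat \<Rightarrow> real) \<Rightarrow> nat \<Rightarrow> nat \<Rightarrow> real" where
  "window a m j = (\<Sum>k\<in>{j..j+m}. a k)"

lemma coeff_sum_monom: "coeff (\<Sum>k\<le>n. monom (a k) k) i = (if i \<le> n then a i else (0::real))"
  by (simp add: coeff_sum if_distrib cong: if_cong)

lemma degree_sum_monom: "degree (\<Sum>k\<le>n. monom (a k) k :: real poly) \<le> n"
  by (intro degree_le) (simp add: coeff_sum_monom del: coeff_sum)

text \<open>In the product with \<open>1 + x + ... + x^m\<close> the inner coefficients are window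
  sums. The \<open>m\<close> positions at either end are all conceded as breaks, which gives
  \<open>2 * m\<close>; the extra factor can only add roots.\<close>

lemma positive_roots_le_breaks_window:
  fixes a :: "nat \<Rightarrow> real" and n m :: nat
  defines "p \<equiv> \<Sum>k\<le>n. monom (a k) k"
  assumes "p \<noteq> 0"
  shows "size (positive_roots p) \<le> 2 * m + card (breaks (window a m) n)"
proof -
  define h :: "real poly" where "h = (\<Sum>k\<le>m. monom 1 k)"
  have h_coeff: "coeff h i = (if i \<le> m then 1 else 0)" for i
    by (simp add: h_def coeff_sum_monom del: coeff_sum)
  have "h \<noteq> 0" using h_coeff[of 0] by auto
  then have "p * h \<noteq> 0" using assms by simp
  have "degree (p * h) \<le> n + m"
    using degree_mult_le[of p h] degree_sum_monom[of a n] degree_sum_monom[of "\<lambda>_. 1" m]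
    by (simp add: p_def h_def)
  have c: "coeff (p * h) (j + m) = window a m j" if "j + m \<le> n" for j
  proof -
    have "coeff (p * h) (j + m) = (\<Sum>i\<le>j+m. if i \<in> {j..j+m} then a i else 0)"
      unfolding coeff_mult using that
      by (intro sum.cong) (auto simp: p_def coeff_sum_monom h_coeff simp del: coeff_sum)
    also have "\<dots> = window a m j"
      unfolding window_def by (subst sum.inter_restrict[symmetric]) (auto intro!: sum.cong)
    finally show ?thesis .
  qed
  \<comment> \<open>A break at \<open>i\<close> involves the entries \<open>i\<close> and
    \<open>Suc i\<close>; both are full window sums when \<open>m <= i < n\<close>.\<close>
  have "breaks (coeff (p * h)) (n + m) \<subseteq> {..<m} \<union> (\<lambda>j. j + m) ` breaks (window a m) n \<union> {n..<n+m}"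
  proof
    fix i assume i: "i \<in> breaks (coeff (p * h)) (n + m)"
    show "i \<in> {..<m} \<union> (\<lambda>j. j + m) ` breaks (window a m) n \<union> {n..<n+m}"
    proof (cases "m \<le> i \<and> i < n")
      case True
      then have "i - m \<in> breaks (window a m) n"
        using i c[of "i - m"] c[of "Suc (i - m)"] by (auto simp: breaks_def)
      then show ?thesis using True by (auto intro!: image_eqI[of _ _ "i - m"])
    qed (use i in \<open>auto simp: breaks_def\<close>)
  qed
  then have "card (breaks (coeff (p * h)) (n + m))
      \<le> card ({..<m} \<union> (\<lambda>j. j + m) ` breaks (window a m) n \<union> {n..<n+m})"
    by (intro card_mono) auto
  also have "\<dots> \<le> card {..<m} + card ((\<lambda>j. j + m) ` breaks (window a m) n) + card {n..<n+m}"
    by (intro order.trans[OF card_Un_le] add_mono card_Un_le) auto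
  also have "\<dots> \<le> 2 * m + card (breaks (window a m) n)"
    by (simp add: card_image)
  finally have "card (breaks (coeff (p * h)) (n + m)) \<le> \<dots>" .
  moreover have "size (positive_roots p) \<le> size (positive_roots (p * h))"
    using \<open>h \<noteq> 0\<close> \<open>p \<noteq> 0\<close> by (simp add: proots_mult)
  ultimately show ?thesis
    using Descartes_bound[OF \<open>p * h \<noteq> 0\<close> \<open>degree (p * h) \<le> n + m\<close>] by linarith
qed

section \<open>Negative roots and the root zero\<close>

lemma proots_pcompose_uminus:
  fixes p :: "real poly"
  assumes "p \<noteq> 0"
  shows "proots (pcompose p [:0, -1:]) = image_mset uminus (proots p)"
  using assms
proof (induction "size (proots p)" arbitrary: p)
  case 0
  then have "poly p x \<noteq> 0" for x using set_count_proots[of p] by auto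
  then have "poly (pcompose p [:0, -1:]) x \<noteq> 0" for x by (simp add: poly_pcompose)
  moreover from this have "pcompose p [:0, -1:] \<noteq> 0" by (metis poly_0)
  ultimately have "set_mset (proots (pcompose p [:0, -1:])) = {}" by simp
  moreover have "proots p = {#}" using 0(1) by simp
  ultimately show ?case by simp
next
  case (Suc k)
  then obtain a where a: "a \<in># proots p"
    by (metis size_eq_Suc_imp_elem)
  then have "poly p a = 0" using Suc by auto
  then obtain q where q: "p = [:-a, 1:] * q" by (metis poly_eq_0_iff_dvd dvdE)
  have "q \<noteq> 0" using q Suc by auto
  then have pr: "proots p = {#a#} + proots q"
    unfolding q by (subst proots_mult) auto
  \<comment> \<open>Reflection sends the factor \<open>x - a\<close> to \<open>-(x + a)\<close>, and
    the outer sign does not affect the roots.\<close>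
  have "pcompose p [:0, -1:] = - ([:a, 1:] * pcompose q [:0, -1:])"
    unfolding q pcompose_mult by (simp add: pcompose_pCons)
  moreover have "pcompose q [:0, -1:] \<noteq> 0"
    using \<open>q \<noteq> 0\<close> by (subst pcompose_eq_0_iff) auto
  ultimately have "proots (pcompose p [:0, -1:]) = {#-a#} + proots (pcompose q [:0, -1:])"
    by (simp add: proots_mult del: mult_pCons_left)
  then show ?case using Suc(1)[of q] Suc(2) \<open>q \<noteq> 0\<close> pr by simp
qed

lemma size_proots_eq:
  fixes p :: "real poly"
  assumes "p \<noteq> 0"
  shows "size (proots p) =
    size (positive_roots p) + size (positive_roots (pcompose p [:0, -1:])) + order 0 p"
proof -
  have "proots p = positive_roots p + filter_mset (\<lambda>x. x < 0) (proots p) + filter_mset (\<lambda>x. x = 0) (proots p)"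
    by (intro multiset_eqI) auto
  then have "size (proots p) = size (positive_roots p)
      + size (filter_mset (\<lambda>x. x < 0) (proots p)) + size (filter_mset (\<lambda>x. x = 0) (proots p))"
    by (metis size_union)
  moreover have "filter_mset (\<lambda>x. x = 0) (proots p) = replicate_mset (order 0 p) 0"
    using assms by (intro multiset_eqI) auto
  moreover have "size (positive_roots (pcompose p [:0, -1:])) = size (filter_mset (\<lambda>x. x < 0) (proots p))"
    using assms by (simp add: proots_pcompose_uminus filter_mset_image_mset)
  ultimately show ?thesis by simp
qed

lemma order_0_le_if_coeff_nonzero:
  fixes p :: "real poly"
  assumes "coeff p k \<noteq> 0"
  shows "order 0 p \<le> k"
proof (rule ccontr)
  assume "\<not> order 0 p \<le> k"
  then have "[:0, 1:] ^ Suc k dvd p"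
    using order_1[of 0 p] by (metis power_le_dvd Suc_le_eq not_le neg_0_equal_iff_equal)
  then obtain q where "p = monom 1 (Suc k) * q"
    by (auto simp: monom_altdef elim: dvdE)
  then have "coeff p k = 0" by (simp add: coeff_monom_mult)
  with assms show False by simp
qed

text \<open>Roots are split by sign, with separate window lengths for the two signs. The index
  \<open>k\<close> of any nonzero coefficient bounds the multiplicity of the root 0 independently of
  \<open>n\<close>.\<close>

lemma num_real_roots_le:
  assumes "\<eta> k \<omega> \<noteq> 0" "k \<le> n"
  shows "num_real_roots (rand_poly \<eta> n \<omega>) \<le>
    2 * m + 2 * m' + k + card (breaks (window (\<lambda>k. \<eta> k \<omega>) m) n)
      + card (breaks (window (\<lambda>k. (-1) ^ k * \<eta> k \<omega>) m') n)"
proof -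
  define p where "p = rand_poly \<eta> n \<omega>"
  have "coeff p k \<noteq> 0" using assms
    by (simp add: p_def rand_poly_def coeff_sum_monom del: coeff_sum)
  then have "p \<noteq> 0" "order 0 p \<le> k" by (auto intro: order_0_le_if_coeff_nonzero)
  have pc: "pcompose p [:0, -1:] = (\<Sum>k\<le>n. monom ((-1) ^ k * \<eta> k \<omega>) k)"
    by (intro poly_eqI)
       (simp add: coeff_pcompose_linear p_def rand_poly_def coeff_sum_monom del: coeff_sum)
  have "pcompose p [:0, -1:] \<noteq> 0"
    using \<open>p \<noteq> 0\<close> by (subst pcompose_eq_0_iff) auto
  then have "size (positive_roots (pcompose p [:0, -1:]))
      \<le> 2 * m' + card (breaks (window (\<lambda>k. (-1) ^ k * \<eta> k \<omega>) m') n)"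
    unfolding pc by (rule positive_roots_le_breaks_window)
  moreover have "size (positive_roots p) \<le> 2 * m + card (breaks (window (\<lambda>k. \<eta> k \<omega>) m) n)"
    using \<open>p \<noteq> 0\<close> unfolding p_def rand_poly_def by (rule positive_roots_le_breaks_window)
  ultimately show ?thesis
    using size_proots_eq[OF \<open>p \<noteq> 0\<close>] \<open>order 0 p \<le> k\<close> \<open>p \<noteq> 0\<close>
    by (simp add: num_real_roots_def p_def[symmetric])
qed

lemma num_real_roots_rand_poly_le: "num_real_roots (rand_poly \<eta> n \<omega>) \<le> n"
proof -
  have "degree (rand_poly \<eta> n \<omega>) \<le> n"
    unfolding rand_poly_def by (rule degree_sum_monom)
  then show ?thesis
    using size_proots_le[of "rand_poly \<eta> n \<omega>"] by (simp add: num_real_roots_def)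
qed

subsection \<open>Measurability of the number of roots\<close>

text \<open>The polynomials of degree at most \<open>n\<close> with at least \<open>k\<close> real roots form a countable union of
  compact sets, being the image of a finite-dimensional space under multiplication of \<open>k\<close> linear
  factors with a polynomial of degree \<open>d = n - k\<close>.\<close>

fun split_coeffs :: "nat \<Rightarrow> nat \<Rightarrow> nat \<Rightarrow> (nat \<Rightarrow> real) set" where
  "split_coeffs 0 d N = Pi\<^sub>E UNIV (\<lambda>j. if j \<le> d then {-real N..real N} else {0})"
| "split_coeffs (Suc k) d N =
    (\<lambda>(a, c) j. (case j of 0 \<Rightarrow> 0 | Suc i \<Rightarrow> c i) - a * c j) ` ({-real N..real N} \<times> split_coeffs k d N)"

text \<open>Compactness refers to the product topology on sequences: the box is compact by
  Tychonoff, and multiplication by a linear factor is continuous in each coordinate.\<close>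

lemma compact_split_coeffs: "compact (split_coeffs k d N)"
proof (induction k)
  case 0
  have "compactin (product_topology (\<lambda>i::nat. euclidean) UNIV) (split_coeffs 0 d N)"
    unfolding split_coeffs.simps by (subst compactin_PiE) auto
  then show ?case by (simp add: euclidean_product_topology)
next
  case (Suc k)
  have snd: "continuous_on S (\<lambda>x. snd x i)" for S :: "(real \<times> (nat \<Rightarrow> real)) set" and i
    by (rule continuous_on_product_then_coordinatewise[OF continuous_on_snd[OF continuous_on_id]])
  have "continuous_on S (\<lambda>x. case j of 0 \<Rightarrow> 0 | Suc i \<Rightarrow> snd x i)"
    for S :: "(real \<times> (nat \<Rightarrow> real)) set" and j
    by (cases j) (simp_all add: snd)
  then have "continuous_on S (\<lambda>(a::real, c::nat \<Rightarrow> real) j. (case j of 0 \<Rightarrow> 0 | Suc i \<Rightarrow> c i) - a * c j)" for S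
    unfolding case_prod_beta
    by (intro continuous_on_coordinatewise_then_product continuous_on_diff continuous_on_mult
          continuous_on_fst continuous_on_id snd)
  then show ?case unfolding split_coeffs.simps
    by (intro compact_continuous_image compact_Times Suc) auto
qed

lemma split_coeffs_mono: "N \<le> N' \<Longrightarrow> split_coeffs k d N \<subseteq> split_coeffs k d N'"
proof (induction k)
  case 0
  then show ?case unfolding split_coeffs.simps by (intro PiE_mono) auto
next
  case (Suc k)
  then have "{-real N..real N} \<times> split_coeffs k d N \<subseteq> {-real N'..real N'} \<times> split_coeffs k d N'"
    by (intro Sigma_mono) auto
  then show ?case unfolding split_coeffs.simps by (rule image_mono)
qed

lemma coeff_linear_factor:
  "coeff ([:-a, 1:] * q) = (\<lambda>j. (case j of 0 \<Rightarrow> 0 | Suc i \<Rightarrow> coeff q i) - a * coeff q j)"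
  for a :: "'a :: comm_ring_1"
  by (auto simp: fun_eq_iff coeff_pCons split: nat.splits)

text \<open>Peeling off \<open>k\<close> roots leaves a quotient of degree at most \<open>d\<close>.
  Only finitely many numbers are involved, so some \<open>N\<close> bounds them all, and the compact
  sets exhaust these polynomials.\<close>

lemma coeff_in_split_coeffs:
  assumes "p \<noteq> 0" "degree p \<le> k + d" "size (proots p) \<ge> k"
  shows "\<exists>N. coeff p \<in> split_coeffs k d N"
  using assms
proof (induction k arbitrary: p)
  case 0
  define B where "B = Max ((\<lambda>j. \<bar>coeff p j\<bar>) ` {..d})"
  obtain N :: nat where N: "B \<le> real N" using real_arch_simple by blast
  have "\<bar>coeff p j\<bar> \<le> real N" if "j \<le> d" for j
    using N that unfolding B_def by (subst (asm) Max_le_iff) auto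
  moreover have "coeff p j = 0" if "\<not> j \<le> d" for j using 0 that by (intro coeff_eq_0) auto
  ultimately have "coeff p \<in> split_coeffs 0 d N" by (auto simp: abs_le_iff minus_le_iff)
  then show ?case by blast
next
  case (Suc k)
  then obtain a where a: "a \<in># proots p"
    by (metis Suc_le_D size_eq_Suc_imp_elem)
  then have "poly p a = 0" using Suc by auto
  then obtain q where q: "p = [:-a, 1:] * q" by (metis poly_eq_0_iff_dvd dvdE)
  have "q \<noteq> 0" using q Suc by auto
  then have "proots p = {#a#} + proots q"
    unfolding q by (subst proots_mult) auto
  moreover have "degree p = Suc (degree q)"
    using \<open>q \<noteq> 0\<close> unfolding q by (subst degree_mult_eq) auto
  ultimately obtain N where N: "coeff q \<in> split_coeffs k d N"
    using Suc.IH[of q] Suc.prems \<open>q \<noteq> 0\<close> by auto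
  obtain N' :: nat where N': "\<bar>a\<bar> \<le> real N'" using real_arch_simple by blast
  have "coeff q \<in> split_coeffs k d (max N N')"
    using N split_coeffs_mono[of N "max N N'"] by auto
  moreover have "a \<in> {-real (max N N')..real (max N N')}" using N' by auto
  ultimately have "coeff p \<in> split_coeffs (Suc k) d (max N N')"
    unfolding q coeff_linear_factor split_coeffs.simps by (intro image_eqI[of _ _ "(a, coeff q)"]) auto
  then show ?case by blast
qed

text \<open>Elements of the box have finite support, hence come from polynomials. The zero
  polynomial needs an exception because the box contains the zero sequence.\<close>

lemma split_coeffs_imp_coeff:
  assumes "c \<in> split_coeffs k d N"
  shows "\<exists>p. c = coeff p \<and> (p \<noteq> 0 \<longrightarrow> size (proots p) \<ge> k)"
  using assms
proof (induction k arbitrary: c)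
  case 0
  then have "c j = 0" if "j > d" for j using that by (auto simp: PiE_iff) (metis not_le singletonD)
  then have "\<forall>\<^sub>\<infinity>j. c j = 0"
    unfolding MOST_nat by blast
  then have "c = coeff (Abs_poly c)" by (simp add: Abs_poly_inverse)
  then show ?case by blast
next
  case (Suc k)
  then obtain a c' where c': "c' \<in> split_coeffs k d N"
    and c: "c = (\<lambda>j. (case j of 0 \<Rightarrow> 0 | Suc i \<Rightarrow> c' i) - a * c' j)" by auto
  then obtain q where q: "c' = coeff q" "q \<noteq> 0 \<longrightarrow> size (proots q) \<ge> k" using Suc.IH by blast
  have "c = coeff ([:-a, 1:] * q)" unfolding c coeff_linear_factor q ..
  moreover have "size (proots ([:-a, 1:] * q)) \<ge> Suc k" if "q \<noteq> 0"
    using that q by (subst proots_mult) auto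
  ultimately show ?case by (metis mult_zero_right)
qed

lemma measurable_num_real_roots [measurable]:
  assumes [measurable]: "\<And>k. \<eta> k \<in> borel_measurable M"
  shows "(\<lambda>\<omega>. real (num_real_roots (rand_poly \<eta> n \<omega>))) \<in> borel_measurable M"
proof -
  have coeff: "coeff (rand_poly \<eta> n \<omega>) = (\<lambda>j. if j \<le> n then \<eta> j \<omega> else 0)" for \<omega>
    by (simp add: fun_eq_iff rand_poly_def coeff_sum if_distrib cong: if_cong)
  have deg: "degree (rand_poly \<eta> n \<omega>) \<le> n" for \<omega>
    by (intro degree_le) (simp add: coeff)
  have nz: "rand_poly \<eta> n \<omega> \<noteq> 0 \<longleftrightarrow> (\<exists>j\<le>n. \<eta> j \<omega> \<noteq> 0)" for \<omega>
    by (auto simp: poly_eq_iff coeff)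
  have [measurable]: "(\<lambda>\<omega>. coeff (rand_poly \<eta> n \<omega>)) \<in> borel_measurable M"
    by (intro measurable_coordinatewise_then_product) (simp add: coeff)
  have [measurable]: "split_coeffs k d N \<in> sets borel" for k d N
    by (intro borel_closed compact_imp_closed compact_split_coeffs)
  \<comment> \<open>The zero polynomial lies in the compact sets but counts as having no roots, so
    it is excluded by a condition of its own; for it the equivalence needs
    \<open>k >= 1\<close>.\<close>
  have iff: "num_real_roots (rand_poly \<eta> n \<omega>) \<ge> k \<longleftrightarrow>
     (\<exists>j\<le>n. \<eta> j \<omega> \<noteq> 0) \<and> (\<exists>N. coeff (rand_poly \<eta> n \<omega>) \<in> split_coeffs k (n - k) N)"
    if "k \<in> {1..n}" for k \<omega>
  proof (cases "rand_poly \<eta> n \<omega> = 0")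
    case False
    have "k \<le> size (proots (rand_poly \<eta> n \<omega>))" if "coeff (rand_poly \<eta> n \<omega>) \<in> split_coeffs k (n - k) N" for N
      using split_coeffs_imp_coeff[OF that] False by (auto simp: coeff_inject)
    then show ?thesis
      using coeff_in_split_coeffs[of "rand_poly \<eta> n \<omega>" k "n - k"] that deg False nz
      by (auto simp: num_real_roots_def)
  qed (use that nz in \<open>auto simp: num_real_roots_def\<close>)
  have "{k \<in> {1..n}. k \<le> num_real_roots (rand_poly \<eta> n \<omega>)} = {1..num_real_roots (rand_poly \<eta> n \<omega>)}" for \<omega>
    using num_real_roots_rand_poly_le[of \<eta> n \<omega>] by auto
  \<comment> \<open>A natural number up to \<open>n\<close> is the sum of the indicators of its
    reaching the levels \<open>1, ..., n\<close>.\<close>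
  then have "real (num_real_roots (rand_poly \<eta> n \<omega>)) =
      (\<Sum>k\<in>{1..n}. if k \<le> num_real_roots (rand_poly \<eta> n \<omega>) then 1 else 0)" for \<omega>
    by (subst sum.inter_filter[symmetric]) simp_all
  also have "\<dots> \<omega> = (\<Sum>k\<in>{1..n}. if (\<exists>j\<le>n. \<eta> j \<omega> \<noteq> 0)
       \<and> (\<exists>N. coeff (rand_poly \<eta> n \<omega>) \<in> split_coeffs k (n - k) N) then 1 else 0)" for \<omega>
    by (intro sum.cong refl if_cong iff)
  finally have "(\<lambda>\<omega>. real (num_real_roots (rand_poly \<eta> n \<omega>))) = (\<lambda>\<omega>. \<Sum>k\<in>{1..n}. if (\<exists>j\<le>n. \<eta> j \<omega> \<noteq> 0)
       \<and> (\<exists>N. coeff (rand_poly \<eta> n \<omega>) \<in> split_coeffs k (n - k) N) then 1 else 0)" ..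
  also have "\<dots> \<in> borel_measurable M" by measurable
  finally show ?thesis .
qed

subsection \<open>Concentration of sums of independent variables\<close>

text \<open>Equality case of the bound by 1: after rotation by the argument of
  \<open>char M z\<close>, the mean of a cosine equals 1, its largest possible value.\<close>

lemma (in real_distribution) AE_cos_eq_1:
  assumes "norm (char M z) = 1"
  obtains \<theta> where "AE x in M. cos (z * x - \<theta>) = 1"
proof -
  define \<theta> where "\<theta> = Arg (char M z)"
  have int: "integrable M (\<lambda>x. cos (z * x - \<theta>))"
    by (rule integrable_const_bound[of _ 1]) auto
  have int_cis: "integrable M (\<lambda>x. cis (-\<theta>) * iexp (z * x))"
    by (intro integrable_mult_right integrable_const_bound[of _ 1]) auto
  have polar: "char M z = cis \<theta>"
    using rcis_cmod_Arg[of "char M z"] assms by (simp add: \<theta>_def rcis_def)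
  have "1 = Re (cis (-\<theta>) * char M z)"
    unfolding polar cis_mult by simp
  also have "\<dots> = Re (CLINT x|M. cis (-\<theta>) * iexp (z * x))"
    by (simp add: char_def)
  also have "\<dots> = (LINT x|M. Re (cis (-\<theta>) * iexp (z * x)))"
    by (rule integral_Re[OF int_cis, symmetric])
  also have "\<dots> = (LINT x|M. cos (z * x - \<theta>))"
    by (intro Bochner_Integration.integral_cong refl)
       (simp add: cis_conv_exp[symmetric] cis_mult flip: of_real_mult)
  finally have "(LINT x|M. 1 - cos (z * x - \<theta>)) = 0"
    using int by (simp add: prob_space del: space_eq_univ)
  moreover have "integrable M (\<lambda>x. 1 - cos (z * x - \<theta>))" using int by simp
  ultimately have "AE x in M. 1 - cos (z * x - \<theta>) = 0"
    by (subst (asm) integral_nonneg_eq_0_iff_AE) auto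
  then show thesis by (intro that[of \<theta>]) auto
qed

text \<open>If all points but one were null, countability of \<open>C\<close> would put the whole
  mass on that point.\<close>

lemma (in real_distribution) ex_two_atoms:
  assumes "countable C" "AE x in M. x \<in> C" "nondegenerate M"
  obtains x y where "x \<noteq> y" "measure M {x} > 0" "measure M {y} > 0"
proof (rule ccontr)
  assume contr: "\<not> thesis"
  \<comment> \<open>If there is no atom at all, any point serves as \<open>x0\<close>.\<close>
  have "\<exists>x0. \<forall>y. y \<noteq> x0 \<longrightarrow> measure M {y} = 0"
  proof (cases "\<exists>x0. measure M {x0} > 0")
    case True
    then show ?thesis using contr that by (metis zero_less_measure_iff)
  qed (simp add: zero_less_measure_iff)
  then obtain x0 where x0: "measure M {y} = 0" if "y \<noteq> x0" for y by blast
  have "AE x in M. \<forall>y\<in>C - {x0}. x \<noteq> y"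
  proof (rule AE_ball_countable')
    fix y assume "y \<in> C - {x0}"
    then have "{y} \<in> null_sets M" using x0 by (auto simp: null_sets_def emeasure_eq_measure)
    from AE_not_in[OF this] show "AE x in M. x \<noteq> y" by simp
  qed (use assms in auto)
  with assms(2) have "AE x in M. x \<in> {x0}" by eventually_elim auto
  then have "measure M {x0} = 1" by (subst (asm) AE_in_set_eq_1) auto
  with assms(3) show False by (auto simp: nondegenerate_def)
qed

lemma countable_cos_eq_1: "z \<noteq> 0 \<Longrightarrow> countable {x. cos (z * x - \<theta>) = (1::real)}"
proof -
  assume "z \<noteq> 0"
  have "{x. cos (z * x - \<theta>) = 1} \<subseteq> range (\<lambda>n::int. (of_int n * 2 * pi + \<theta>) / z)"
    using \<open>z \<noteq> 0\<close> by (auto simp: cos_one_2pi_int image_iff field_simps)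
  then show ?thesis by (rule countable_subset) auto
qed

text \<open>A single nonzero \<open>z\<close> in this set confines the law to a countable set and so
  yields two atoms \<open>x\<close>, \<open>y\<close>. Every further \<open>z\<close> in the set
  must make \<open>z * (x - y)\<close> a multiple of \<open>2 * pi\<close>.\<close>

lemma (in real_distribution) countable_norm_char_eq_1:
  assumes "nondegenerate M"
  shows "countable {z. norm (char M z) = 1}"
proof (cases "\<exists>z. z \<noteq> 0 \<and> norm (char M z) = 1")
  case True
  then obtain z where "z \<noteq> 0" "norm (char M z) = 1" by blast
  moreover from this obtain \<theta> where "AE x in M. cos (z * x - \<theta>) = 1" by (elim AE_cos_eq_1)
  ultimately obtain x y where xy: "x \<noteq> y" "measure M {x} > 0" "measure M {y} > 0"
    using ex_two_atoms[OF countable_cos_eq_1[of z \<theta>] _ assms] by auto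
  have "{z. norm (char M z) = 1} \<subseteq> range (\<lambda>n::int. of_int n * 2 * pi / (x - y))"
  proof safe
    fix z assume "norm (char M z) = 1"
    then obtain \<theta> where \<theta>: "AE x in M. cos (z * x - \<theta>) = 1" by (elim AE_cos_eq_1)
    have atom: "cos (z * x - \<theta>) = 1" if "measure M {x} > 0" for x
    proof (rule ccontr)
      assume "cos (z * x - \<theta>) \<noteq> 1"
      with \<theta> have "AE y in M. y \<notin> {x}" by (auto elim: eventually_mono)
      then have "measure M {x} = 0" by (simp add: AE_iff_measurable[OF _ refl] measure_def)
      with that show False by simp
    qed
    obtain m n :: int where "z * x - \<theta> = of_int m * 2 * pi" "z * y - \<theta> = of_int n * 2 * pi"
      using atom[OF xy(2)] atom[OF xy(3)] by (auto simp: cos_one_2pi_int)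
    then have "z * (x - y) = of_int (m - n) * 2 * pi" by (simp add: algebra_simps)
    then have "z = of_int (m - n) * 2 * pi / (x - y)" using xy(1) by (simp add: field_simps)
    then show "z \<in> range (\<lambda>n::int. of_int n * 2 * pi / (x - y))" by blast
  qed
  then show ?thesis by (rule countable_subset) auto
next
  case False
  then have "{z. norm (char M z) = 1} \<subseteq> {0}" by auto
  then show ?thesis by (rule countable_subset) auto
qed

text \<open>Since the standard normal density is (up to scaling) its own Fourier transform,
  \<open>E exp (-X^2/2)\<close> is the mean of the characteristic function of \<open>X\<close> at a normal point.\<close>

lemma (in real_distribution) measure_interval_le_char:
  "measure M {-L..L} \<le> exp (L\<^sup>2 / 2) * (LINT z|std_normal_distribution. norm (char M z))"
proof -
  interpret N: real_distribution std_normal_distribution by (rule real_dist_normal_dist)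
  interpret MN: pair_prob_space M std_normal_distribution ..
  have int: "integrable M (\<lambda>x. exp (- x\<^sup>2 / 2))"
    by (rule integrable_const_bound[of _ 1]) auto
  \<comment> \<open>On \<open>{-L..L}\<close> the function \<open>exp (-x^2/2)\<close> is at least
    \<open>exp (-L^2/2)\<close>, as in Markov's inequality.\<close>
  have "exp (- L\<^sup>2 / 2) * measure M {-L..L} = (LINT x|M. exp (- L\<^sup>2 / 2) * indicator {-L..L} x)"
    by simp
  also have "\<dots> \<le> (LINT x|M. exp (- x\<^sup>2 / 2))"
  proof (intro integral_mono int)
    fix x :: real
    show "exp (- L\<^sup>2 / 2) * indicator {-L..L} x \<le> exp (- x\<^sup>2 / 2)"
      by (auto simp: indicator_def abs_le_square_iff[symmetric])
  qed (auto intro!: integrable_const_bound[of _ 1])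
  also have "\<dots> = Re (CLINT x|M. char std_normal_distribution x)"
    using int by (simp add: char_std_normal_distribution)
  also have "(CLINT x|M. char std_normal_distribution x) =
      (CLINT x|M. CLINT z|std_normal_distribution. iexp (x * z))"
    by (simp add: char_def)
  also have "\<dots> = (CLINT z|std_normal_distribution. CLINT x|M. iexp (x * z))"
    by (intro MN.Fubini_integral[symmetric] MN.integrable_const_bound[of _ 1]) auto
  also have "\<dots> = (CLINT z|std_normal_distribution. char M z)"
    by (simp add: char_def mult.commute)
  also have "Re \<dots> \<le> norm \<dots>" by (rule complex_Re_le_cmod)
  also have "\<dots> \<le> (LINT z|std_normal_distribution. norm (char M z))"
    by (rule integral_norm_bound)
  finally have "exp (L\<^sup>2 / 2) * (exp (- L\<^sup>2 / 2) * measure M {-L..L}) \<le>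
    exp (L\<^sup>2 / 2) * (LINT z|std_normal_distribution. norm (char M z))"
    by (intro mult_left_mono) auto
  then show ?thesis by (simp add: mult.assoc[symmetric] exp_add[symmetric])
qed

text \<open>Off a countable, hence null, set all the finitely many characteristic functions have
  modulus below 1, and so has their maximum. Its powers tend to 0, and dominated convergence
  applies. The exponent \<open>Suc m\<close> is the number of terms in a window.\<close>

lemma ex_integral_Max_char_power_less:
  fixes D :: "real measure set"
  assumes D: "finite D" "D \<noteq> {}" "\<And>\<mu>. \<mu> \<in> D \<Longrightarrow> real_distribution \<mu> \<and> nondegenerate \<mu>"
    and "\<epsilon> > 0"
  shows "\<exists>m. (LINT z|std_normal_distribution. Max ((\<lambda>\<mu>. norm (char \<mu> z)) ` D) ^ Suc m) < \<epsilon>"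
proof -
  interpret N: real_distribution std_normal_distribution by (rule real_dist_normal_dist)
  define \<psi> where "\<psi> z = Max ((\<lambda>\<mu>. norm (char \<mu> z)) ` D)" for z
  have [measurable]: "char \<mu> \<in> borel_measurable borel" if "\<mu> \<in> D" for \<mu>
    using D(3)[OF that] real_distribution.char_measurable by blast
  have [measurable]: "\<psi> \<in> borel_measurable borel"
    unfolding \<psi>_def by (intro borel_measurable_Max D) measurable
  have \<psi>: "0 \<le> \<psi> z" "\<psi> z \<le> 1" for z
    unfolding \<psi>_def using D real_distribution.cmod_char_le_1
    by (auto simp: Max_ge_iff)
  have null: "(\<Union>\<mu>\<in>D. {z. norm (char \<mu> z) = 1}) \<in> null_sets lborel"
    using D by (intro countable_imp_null_set_lborel countable_UN)
       (auto intro: countable_finite real_distribution.countable_norm_char_eq_1)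
  have "AE z in std_normal_distribution. \<psi> z < 1"
  proof (subst AE_density)
    show "AE z in lborel. 0 < ennreal (std_normal_density z) \<longrightarrow> \<psi> z < 1"
      using AE_not_in[OF null]
    proof eventually_elim
      case (elim z)
      then have "norm (char \<mu> z) < 1" if "\<mu> \<in> D" for \<mu>
        using that D real_distribution.cmod_char_le_1[of \<mu> z] by force
      then show ?case using D by (auto simp: \<psi>_def)
    qed
  qed auto
  then have "AE z in std_normal_distribution. (\<lambda>m. \<psi> z ^ Suc m) \<longlonglongrightarrow> 0"
    by eventually_elim (use \<psi> in \<open>auto intro!: LIMSEQ_Suc LIMSEQ_power_zero simp del: power_Suc\<close>)
  then have "(\<lambda>m. LINT z|std_normal_distribution. \<psi> z ^ Suc m) \<longlonglongrightarrow> (LINT z|std_normal_distribution. 0)"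
    by (intro integral_dominated_convergence[where w = "\<lambda>_. 1"])
       (use \<psi> in \<open>auto intro!: power_le_one AE_I2 simp del: power_Suc\<close>)
  then have "eventually (\<lambda>m. (LINT z|std_normal_distribution. \<psi> z ^ Suc m) < \<epsilon>) sequentially"
    using \<open>\<epsilon> > 0\<close> by (intro order_tendstoD(2)) auto
  then show ?thesis by (auto simp: \<psi>_def eventually_sequentially simp del: power_Suc)
qed

text \<open>By independence the characteristic function of the sum is a product, each factor of
  which is bounded in modulus by the maximum over \<open>D\<close>.\<close>

lemma (in prob_space) prob_abs_sum_le:
  fixes X :: "'i \<Rightarrow> 'a \<Rightarrow> real" and L :: real
  assumes indep: "indep_vars (\<lambda>_. borel) X A" and A: "finite A"
    and D: "finite D" "\<And>i. i \<in> A \<Longrightarrow> distr M borel (X i) \<in> D"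
     "\<And>\<mu>. \<mu> \<in> D \<Longrightarrow> real_distribution \<mu>" "D \<noteq> {}"
  shows "\<P>(\<omega> in M. \<bar>\<Sum>i\<in>A. X i \<omega>\<bar> \<le> L)
    \<le> exp (L\<^sup>2 / 2) * (LINT z|std_normal_distribution. Max ((\<lambda>\<mu>. norm (char \<mu> z)) ` D) ^ card A)"
proof -
  interpret N: real_distribution std_normal_distribution by (rule real_dist_normal_dist)
  define \<psi> where "\<psi> z = Max ((\<lambda>\<mu>. norm (char \<mu> z)) ` D)" for z
  have [measurable]: "char \<mu> \<in> borel_measurable borel" if "\<mu> \<in> D" for \<mu>
    using D(3)[OF that] real_distribution.char_measurable by blast
  have [measurable]: "\<psi> \<in> borel_measurable borel"
    unfolding \<psi>_def by (intro borel_measurable_Max D) measurable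
  have \<psi>: "0 \<le> \<psi> z" "\<psi> z \<le> 1" for z
    unfolding \<psi>_def using D real_distribution.cmod_char_le_1
    by (auto simp: Max_ge_iff)
  have [measurable]: "X i \<in> borel_measurable M" if "i \<in> A" for i
    using indep that by (auto simp: indep_vars_def)
  define S where "S \<omega> = (\<Sum>i\<in>A. X i \<omega>)" for \<omega>
  have [measurable]: "S \<in> borel_measurable M" unfolding S_def by measurable
  interpret S: real_distribution "distr M borel S" by (rule real_distribution_distr) simp
  have "\<P>(\<omega> in M. \<bar>S \<omega>\<bar> \<le> L) = measure (distr M borel S) {-L..L}"
    by (subst measure_distr) (auto intro!: arg_cong[of _ _ prob])
  also have "\<dots> \<le> exp (L\<^sup>2 / 2) * (LINT z|std_normal_distribution. norm (char (distr M borel S) z))"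
    by (rule S.measure_interval_le_char)
  also have "(LINT z|std_normal_distribution. norm (char (distr M borel S) z))
    \<le> (LINT z|std_normal_distribution. \<psi> z ^ card A)"
  proof (rule integral_mono)
    show "integrable std_normal_distribution (\<lambda>z. norm (char (distr M borel S) z))"
      by (rule N.integrable_const_bound[of _ 1]) (auto simp: S.cmod_char_le_1)
    show "integrable std_normal_distribution (\<lambda>z. \<psi> z ^ card A)"
      by (rule N.integrable_const_bound[of _ 1]) (auto simp: \<psi> power_le_one)
    fix z
    have "norm (char (distr M borel S) z) = (\<Prod>i\<in>A. norm (char (distr M borel (X i)) z))"
      unfolding S_def char_distr_sum[OF indep] by (rule prod_norm[symmetric])
    also have "\<dots> \<le> (\<Prod>i\<in>A. \<psi> z)"
      unfolding \<psi>_def using D by (intro prod_mono) auto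
    finally show "norm (char (distr M borel S) z) \<le> \<psi> z ^ card A" by simp
  qed
  finally show ?thesis by (simp add: S_def \<psi>_def)
qed

section \<open>Uniform tightness of finitely many laws\<close>

lemma (in real_distribution) tight:
  assumes "\<epsilon> > 0"
  shows "\<exists>T. measure M {x. \<bar>x\<bar> > T} < \<epsilon>"
proof -
  have "(\<lambda>n. measure M {x. \<bar>x\<bar> > real n}) \<longlonglongrightarrow> measure M (\<Inter>n. {x. \<bar>x\<bar> > real n})"
    by (intro finite_Lim_measure_decseq) (auto simp: decseq_def)
  also have "(\<Inter>n. {x::real. \<bar>x\<bar> > real n}) = {}"
    by auto (metis not_less real_arch_simple)
  finally have "eventually (\<lambda>n. measure M {x. \<bar>x\<bar> > real n} < \<epsilon>) sequentially"
    using assms by (intro order_tendstoD(2)) auto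
  then show ?thesis by (auto simp: eventually_sequentially)
qed

lemma finite_tight:
  assumes "finite D" "\<And>\<mu>. \<mu> \<in> D \<Longrightarrow> real_distribution \<mu>" "\<epsilon> > 0"
  shows "\<exists>T. \<forall>\<mu>\<in>D. measure \<mu> {x. \<bar>x\<bar> > T} < \<epsilon>"
proof -
  have "\<forall>\<mu>\<in>D. \<exists>T. measure \<mu> {x. \<bar>x\<bar> > T} < \<epsilon>"
    using assms real_distribution.tight by blast
  then obtain T where T: "measure \<mu> {x. \<bar>x\<bar> > T \<mu>} < \<epsilon>" if "\<mu> \<in> D" for \<mu>
    by metis
  have "measure \<mu> {x. \<bar>x\<bar> > Max (T ` D)} < \<epsilon>" if "\<mu> \<in> D" for \<mu>
  proof -
    interpret real_distribution \<mu> using assms that by blast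
    have "T \<mu> \<le> Max (T ` D)" using assms that by auto
    then have "measure \<mu> {x. \<bar>x\<bar> > Max (T ` D)} \<le> measure \<mu> {x. \<bar>x\<bar> > T \<mu>}"
      by (intro finite_measure_mono) auto
    with T[OF that] show ?thesis by simp
  qed
  then show ?thesis by blast
qed

subsection \<open>Almost sure bounds\<close>

lemma window_Suc: "window a m (Suc j) = window a m j - a j + a (j + Suc m)"
proof -
  have "window a m j = a j + sum a {Suc j..j + m}"
    unfolding window_def by (subst sum.atLeast_Suc_atMost) auto
  moreover have "window a m (Suc j) = sum a {Suc j..j + m} + a (j + Suc m)"
    unfolding window_def by (simp add: sum.cl_ivl_Suc)
  ultimately show ?thesis by simp
qed

text \<open>Consecutive window sums differ by \<open>a (j + Suc m) - a j\<close>. If both terms are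
  at most \<open>T\<close> in absolute value, a window sum beyond \<open>2 * T\<close> keeps its
  strict sign.\<close>

lemma break_imp:
  assumes "\<not> window a m j * window a m (Suc j) > 0"
  shows "\<bar>window a m j\<bar> \<le> 2 * T \<or> \<bar>a j\<bar> > T \<or> \<bar>a (j + Suc m)\<bar> > T"
proof (rule ccontr)
  assume *: "\<not> ?thesis"
  show False
  proof (cases "window a m j > 0")
    case True
    with * window_Suc[of a m j] have "window a m (Suc j) > 0" by linarith
    with True assms show False by simp
  next
    case False
    with * window_Suc[of a m j] have "window a m j < 0" "window a m (Suc j) < 0" by linarith+
    with assms show False by (simp add: zero_less_mult_iff)
  qed
qed

context prob_space
begin

text \<open>Each of the three events in \<open>break_imp\<close> gets probability at most
  \<open>\<delta> / 3\<close>. First \<open>T\<close> is fixed by tightness, then \<open>m\<close>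
  is chosen for this \<open>T\<close>; both depend only on \<open>D\<close> and
  \<open>\<delta>\<close>, whence the uniformity in \<open>j\<close>.\<close>

lemma ex_window_prob_break_le:
  fixes \<xi> :: "nat \<Rightarrow> 'a \<Rightarrow> real"
  assumes indep: "indep_vars (\<lambda>_. borel) \<xi> UNIV"
    and D: "finite D" "\<And>k. distr M borel (\<xi> k) \<in> D"
      "\<And>\<mu>. \<mu> \<in> D \<Longrightarrow> real_distribution \<mu> \<and> nondegenerate \<mu>"
    and "\<delta> > 0"
  shows "\<exists>m. \<forall>j. \<P>(\<omega> in M. \<not> window (\<lambda>k. \<xi> k \<omega>) m j * window (\<lambda>k. \<xi> k \<omega>) m (Suc j) > 0) \<le> \<delta>"
proof -
  have [measurable]: "\<xi> k \<in> borel_measurable M" for k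
    using indep by (auto simp: indep_vars_def)
  have "D \<noteq> {}" using D(2) by auto
  obtain T where T: "measure \<mu> {x. \<bar>x\<bar> > T} < \<delta> / 3" if "\<mu> \<in> D" for \<mu>
    using finite_tight[of D "\<delta> / 3"] D \<open>\<delta> > 0\<close> by auto
  \<comment> \<open>The factor in front of the concentration bound for \<open>L = 2 * T\<close>, to
    be beaten by the choice of \<open>m\<close>.\<close>
  define E where "E = exp ((2 * T)\<^sup>2 / 2)"
  obtain m where m: "(LINT z|std_normal_distribution. Max ((\<lambda>\<mu>. norm (char \<mu> z)) ` D) ^ Suc m) < \<delta> / 3 / E"
    using ex_integral_Max_char_power_less[of D "\<delta> / 3 / E"] D \<open>D \<noteq> {}\<close> \<open>\<delta> > 0\<close> by (auto simp: E_def)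
  show ?thesis
  proof (intro exI[of _ m] allI)
    fix j
    let ?S = "\<lambda>\<omega>. window (\<lambda>k. \<xi> k \<omega>) m j"
    have [measurable]: "(\<lambda>\<omega>. window (\<lambda>k. \<xi> k \<omega>) m i) \<in> borel_measurable M" for i
      unfolding window_def by measurable
    have tail: "\<P>(\<omega> in M. \<bar>\<xi> k \<omega>\<bar> > T) \<le> \<delta> / 3" for k
    proof -
      have "\<P>(\<omega> in M. \<bar>\<xi> k \<omega>\<bar> > T) = measure (distr M borel (\<xi> k)) {x. \<bar>x\<bar> > T}"
        by (subst measure_distr) (auto intro!: arg_cong[of _ _ prob])
      with T[OF D(2)[of k]] show ?thesis by simp
    qed
    have "\<P>(\<omega> in M. \<bar>?S \<omega>\<bar> \<le> 2 * T) \<le> E * (LINT z|std_normal_distribution.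
            Max ((\<lambda>\<mu>. norm (char \<mu> z)) ` D) ^ card {j..j+m})"
      unfolding window_def E_def using D \<open>D \<noteq> {}\<close>
      by (intro prob_abs_sum_le indep_vars_subset[OF indep]) auto
    also have "\<dots> \<le> E * (\<delta> / 3 / E)"
      using m by (intro mult_left_mono) (auto simp: E_def)
    also have "\<dots> = \<delta> / 3" by (simp add: E_def)
    finally have S: "\<P>(\<omega> in M. \<bar>?S \<omega>\<bar> \<le> 2 * T) \<le> \<delta> / 3" .
    have "\<P>(\<omega> in M. \<not> ?S \<omega> * window (\<lambda>k. \<xi> k \<omega>) m (Suc j) > 0) \<le>
       prob ({\<omega>\<in>space M. \<bar>?S \<omega>\<bar> \<le> 2 * T} \<union> ({\<omega>\<in>space M. \<bar>\<xi> j \<omega>\<bar> > T} \<union> {\<omega>\<in>space M. \<bar>\<xi> (j + Suc m) \<omega>\<bar> > T}))"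
      by (intro finite_measure_mono) (use break_imp[where T = T] in blast, measurable)
    also have "\<dots> \<le> \<P>(\<omega> in M. \<bar>?S \<omega>\<bar> \<le> 2 * T) +
       (\<P>(\<omega> in M. \<bar>\<xi> j \<omega>\<bar> > T) + \<P>(\<omega> in M. \<bar>\<xi> (j + Suc m) \<omega>\<bar> > T))"
      by (intro order.trans[OF measure_Un_le] add_left_mono measure_Un_le) measurable
    also have "\<dots> \<le> \<delta>" using S tail[of j] tail[of "j + Suc m"] by simp
    finally show "\<P>(\<omega> in M. \<not> ?S \<omega> * window (\<lambda>k. \<xi> k \<omega>) m (Suc j) > 0) \<le> \<delta>" .
  qed
qed

text \<open>Hoeffding's inequality with deviation \<open>\<delta> * real N\<close> gives a geometric
  bound, which is summable, so Borel-Cantelli applies.\<close>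

lemma AE_eventually_sum_less:
  fixes X :: "nat \<Rightarrow> 'a \<Rightarrow> real"
  assumes indep: "indep_vars (\<lambda>_. borel) X UNIV"
    and X: "\<And>i \<omega>. X i \<omega> \<in> {0..1}" "\<And>i. expectation (X i) \<le> \<delta>" and "\<delta> > 0"
  shows "AE \<omega> in M. \<forall>\<^sub>F N in sequentially. (\<Sum>i<N. X i \<omega>) < 2 * \<delta> * real N"
proof -
  have [measurable]: "X i \<in> borel_measurable M" for i
    using indep by (auto simp: indep_vars_def)
  define A where "A N = {\<omega>\<in>space M. (\<Sum>i<N. X i \<omega>) \<ge> 2 * \<delta> * real N}" for N
  have A: "A N \<in> sets M" for N unfolding A_def by measurable
  have bound: "prob (A N) \<le> exp (- 2 * \<delta>\<^sup>2) ^ N" for N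
  proof (cases "N = 0")
    case False
    interpret Hoeffding_ineq M "{..<N}" X "\<lambda>_. 0" "\<lambda>_. 1" "\<Sum>i<N. expectation (X i)"
      using X by unfold_locales (auto intro: indep_vars_subset[OF indep])
    have "(\<Sum>i<N. expectation (X i)) \<le> \<delta> * real N"
      using sum_bounded_above[of "{..<N}" "\<lambda>i. expectation (X i)" \<delta>] X(2) by (simp add: mult.commute)
    \<comment> \<open>The means are only bounded above by \<open>\<delta>\<close>; reaching
      \<open>2 * \<delta> * real N\<close> still means exceeding the true mean by at least
      \<open>\<delta> * real N\<close>.\<close>
    then have "prob (A N) \<le> prob {\<omega>\<in>space M. (\<Sum>i<N. X i \<omega>) \<ge> (\<Sum>i<N. expectation (X i)) + \<delta> * real N}"
      by (intro finite_measure_mono) (auto simp: A_def)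
    also have "\<dots> \<le> exp (-2 * (\<delta> * real N)\<^sup>2 / real N)"
      using Hoeffding_ineq_ge[of "\<delta> * real N"] False \<open>\<delta> > 0\<close> by simp
    also have "-2 * (\<delta> * real N)\<^sup>2 / real N = real N * (- 2 * \<delta>\<^sup>2)"
      using False by (simp add: power2_eq_square)
    also have "exp \<dots> = exp (- 2 * \<delta>\<^sup>2) ^ N" by (rule exp_of_nat_mult)
    finally show ?thesis .
  qed simp
  have "summable (\<lambda>N. prob (A N))"
    by (rule summable_comparison_test'[OF summable_geometric[of "exp (- 2 * \<delta>\<^sup>2)"]])
       (use bound \<open>\<delta> > 0\<close> in auto)
  from borel_cantelli_AE1[OF A _ this] show ?thesis
    by (auto simp: A_def less_top[symmetric] not_le elim!: eventually_mono)
qed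

text \<open>A break at \<open>j\<close> depends only on the \<open>m + 2\<close> variables with
  indices from \<open>j\<close> to \<open>j + m + 1\<close>. Along a residue class modulo
  \<open>m + 2\<close> these blocks are disjoint, so the break indicators are independent; the
  bounds for the classes are then added up.\<close>

lemma AE_eventually_breaks_window_le:
  fixes \<xi> :: "nat \<Rightarrow> 'a \<Rightarrow> real"
  assumes indep: "indep_vars (\<lambda>_. borel) \<xi> UNIV"
    and D: "finite D" "\<And>k. distr M borel (\<xi> k) \<in> D"
      "\<And>\<mu>. \<mu> \<in> D \<Longrightarrow> real_distribution \<mu> \<and> nondegenerate \<mu>"
    and "\<epsilon> > 0"
  shows "\<exists>m. AE \<omega> in M. \<forall>\<^sub>F n in sequentially.
    real (card (breaks (window (\<lambda>k. \<xi> k \<omega>) m) n)) \<le> \<epsilon> * real n"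
proof -
  have [measurable]: "\<xi> k \<in> borel_measurable M" for k
    using indep by (auto simp: indep_vars_def)
  \<comment> \<open>The final bound is \<open>2 * \<delta> * (n + q)\<close>, which is at most
    \<open>3 * \<delta> * n\<close> as soon as \<open>n >= 2 * q\<close>.\<close>
  define \<delta> where "\<delta> = \<epsilon> / 3"
  have "\<delta> > 0" using \<open>\<epsilon> > 0\<close> by (simp add: \<delta>_def)
  from ex_window_prob_break_le[OF indep D this] obtain m where m:
    "\<P>(\<omega> in M. \<not> window (\<lambda>k. \<xi> k \<omega>) m j * window (\<lambda>k. \<xi> k \<omega>) m (Suc j) > 0) \<le> \<delta>" for j by blast
  define q where "q = Suc (Suc m)"
  define f :: "nat \<Rightarrow> (nat \<Rightarrow> real) \<Rightarrow> real"
    where "f j a = of_bool (\<not> window a m j * window a m (Suc j) > 0)" for j a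
  have "AE \<omega> in M. \<forall>\<^sub>F N in sequentially. (\<Sum>i<N. f (i * q + s) (\<lambda>k. \<xi> k \<omega>)) < 2 * \<delta> * real N" for s
  proof (rule AE_eventually_sum_less)
    define K where "K i = {i * q + s..i * q + s + Suc m}" for i
    have "disjoint_family K"
      unfolding disjoint_family_on_def
    proof (intro ballI impI)
      fix i j :: nat assume "i \<noteq> j"
      have "K i \<inter> K j = {}" if "i < j" for i j
      proof -
        have "Suc i * q \<le> j * q" using that by (intro mult_le_mono1) auto
        then show ?thesis by (auto simp: K_def q_def)
      qed
      with \<open>i \<noteq> j\<close> show "K i \<inter> K j = {}" by (metis linorder_neqE_nat inf_commute)
    qed
    then have "indep_vars (\<lambda>i. PiM (K i) (\<lambda>_. borel)) (\<lambda>i \<omega>. restrict (\<lambda>k. \<xi> k \<omega>) (K i)) UNIV"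
      by (intro indep_vars_restrict[OF indep]) auto
    then have "indep_vars (\<lambda>_. borel) (\<lambda>i \<omega>. f (i * q + s) (restrict (\<lambda>k. \<xi> k \<omega>) (K i))) UNIV"
    proof (rule indep_vars_compose2)
      fix i
      have [measurable]: "(\<lambda>a. a k) \<in> borel_measurable (PiM (K i) (\<lambda>_. borel :: real measure))" if "k \<in> K i" for k
        using that by measurable
      have "(\<lambda>a. window a m (i * q + s)) \<in> borel_measurable (PiM (K i) (\<lambda>_. borel))"
           "(\<lambda>a. window a m (Suc (i * q + s))) \<in> borel_measurable (PiM (K i) (\<lambda>_. borel))"
        unfolding window_def by (intro borel_measurable_sum; simp add: K_def)+
      note [measurable] = this
      show "f (i * q + s) \<in> borel_measurable (PiM (K i) (\<lambda>_. borel))"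
        unfolding f_def by measurable
    qed
    \<comment> \<open>The indicator reads only entries of its block, so the restriction can be
      removed.\<close>
    moreover have "f (i * q + s) (restrict (\<lambda>k. \<xi> k \<omega>) (K i)) = f (i * q + s) (\<lambda>k. \<xi> k \<omega>)" for i \<omega>
    proof -
      have "window (restrict (\<lambda>k. \<xi> k \<omega>) (K i)) m j = window (\<lambda>k. \<xi> k \<omega>) m j"
        if "j = i * q + s \<or> j = Suc (i * q + s)" for j
        using that unfolding window_def by (intro sum.cong) (auto simp: K_def)
      then show ?thesis by (simp add: f_def)
    qed
    ultimately show "indep_vars (\<lambda>_. borel) (\<lambda>i \<omega>. f (i * q + s) (\<lambda>k. \<xi> k \<omega>)) UNIV" by simp
  next
    fix i
    let ?B = "{\<omega>\<in>space M. \<not> window (\<lambda>k. \<xi> k \<omega>) m (i * q + s) * window (\<lambda>k. \<xi> k \<omega>) m (Suc (i * q + s)) > 0}"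
    have [measurable]: "(\<lambda>\<omega>. window (\<lambda>k. \<xi> k \<omega>) m i) \<in> borel_measurable M" for i
      unfolding window_def by measurable
    have "expectation (\<lambda>\<omega>. f (i * q + s) (\<lambda>k. \<xi> k \<omega>)) = expectation (indicator ?B)"
      by (intro Bochner_Integration.integral_cong) (auto simp: f_def indicator_def)
    also have "\<dots> = prob ?B" by simp
    also have "\<dots> \<le> \<delta>" by (rule m)
    finally show "expectation (\<lambda>\<omega>. f (i * q + s) (\<lambda>k. \<xi> k \<omega>)) \<le> \<delta>" .
  qed (auto simp: f_def \<open>\<delta> > 0\<close>)
  then have "AE \<omega> in M. \<forall>s\<in>{..<q}. \<forall>\<^sub>F N in sequentially. (\<Sum>i<N. f (i * q + s) (\<lambda>k. \<xi> k \<omega>)) < 2 * \<delta> * real N"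
    by (intro AE_ball_countable') auto
  then have "AE \<omega> in M. \<forall>\<^sub>F n in sequentially. real (card (breaks (window (\<lambda>k. \<xi> k \<omega>) m) n)) \<le> \<epsilon> * real n"
  proof eventually_elim
    case (elim \<omega>)
    define g where "g j = f j (\<lambda>k. \<xi> k \<omega>)" for j
    have g: "0 \<le> g j" for j by (simp add: g_def f_def)
    from elim have "\<forall>\<^sub>F N in sequentially. \<forall>s\<in>{..<q}. (\<Sum>i<N. g (i * q + s)) < 2 * \<delta> * real N"
      unfolding g_def by (intro eventually_ball_finite) auto
    then obtain N0 where N0: "\<And>N s. N \<ge> N0 \<Longrightarrow> s < q \<Longrightarrow> (\<Sum>i<N. g (i * q + s)) < 2 * \<delta> * real N"
      by (auto simp: eventually_sequentially)
    show ?case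
    \<comment> \<open>The term \<open>q * N0\<close> makes the number of blocks reach
      \<open>N0\<close>; the term \<open>2 * q\<close> absorbs the rounding of \<open>n\<close> up
      to a multiple of \<open>q\<close>.\<close>
    proof (rule eventually_sequentiallyI[of "q * N0 + 2 * q"])
      fix n assume n: "n \<ge> q * N0 + 2 * q"
      define N where "N = Suc (n div q)"
      have "q > 0" by (simp add: q_def)
      have "n < N * q" using \<open>q > 0\<close> unfolding N_def by (metis dividend_less_div_times mult_Suc add.commute)
      have "N * q \<le> n + q" by (simp add: N_def)
      have "N0 \<le> n div q" using n \<open>q > 0\<close> by (subst less_eq_div_iff_mult_less_eq) (auto simp: mult.commute)
      then have "N \<ge> N0" by (simp add: N_def)
      have "real (card (breaks (window (\<lambda>k. \<xi> k \<omega>) m) n)) = (\<Sum>j<n. g j)"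
      proof -
        have "breaks a n = {..<n} \<inter> {j. \<not> a j * a (Suc j) > 0}" for a by (auto simp: breaks_def)
        then show ?thesis by (simp add: g_def f_def sum_of_bool_eq)
      qed
      also have "\<dots> \<le> (\<Sum>j<N * q. g j)"
        using g \<open>n < N * q\<close> by (intro sum_mono2) auto
      also have "\<dots> = (\<Sum>i<N. \<Sum>j\<in>{i * q..<i * q + q}. g j)"
        by (rule sum.nat_group[symmetric])
      also have "\<dots> = (\<Sum>i<N. \<Sum>s<q. g (i * q + s))"
        by (rule sum.cong[OF refl]) (subst sum.atLeastLessThan_shift_0, simp add: atLeast0LessThan)
      also have "\<dots> = (\<Sum>s<q. \<Sum>i<N. g (i * q + s))"
        by (rule sum.swap)
      also have "\<dots> \<le> (\<Sum>s<q. 2 * \<delta> * real N)"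
        using N0 \<open>N \<ge> N0\<close> by (intro sum_mono less_imp_le) auto
      also have "\<dots> = 2 * \<delta> * real (N * q)" by simp
      also have "\<dots> \<le> 2 * \<delta> * real (n + q)"
        using \<open>\<delta> > 0\<close> \<open>N * q \<le> n + q\<close> by (intro mult_left_mono) (auto simp only: of_nat_mono)
      also have "\<dots> \<le> \<epsilon> * real n"
      proof -
        have "2 * real q \<le> real n" using n by linarith
        then have "2 * \<delta> * real (n + q) \<le> \<delta> * (3 * real n)"
          using \<open>\<delta> > 0\<close> by (simp add: algebra_simps)
        then show ?thesis by (simp add: \<delta>_def)
      qed
      finally show "real (card (breaks (window (\<lambda>k. \<xi> k \<omega>) m) n)) \<le> \<epsilon> * real n" .
    qed
  qed
  then show ?thesis by blast
qed

end

section \<open>From breaks to the number of real roots\<close>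

lemma num_real_roots_div_tendsto_0:
  assumes "\<And>i. \<exists>m. \<forall>\<^sub>F n in sequentially. real (card (breaks (window (\<lambda>k. \<eta> k \<omega>) m) n)) \<le> inverse (real (Suc i)) * real n"
    and "\<And>i. \<exists>m. \<forall>\<^sub>F n in sequentially.
      real (card (breaks (window (\<lambda>k. (-1) ^ k * \<eta> k \<omega>) m) n)) \<le> inverse (real (Suc i)) * real n"
  shows "(\<lambda>n. real (num_real_roots (rand_poly \<eta> n \<omega>)) / real n) \<longlonglongrightarrow> 0"
proof -
  \<comment> \<open>For the zero sequence every index is a break, which contradicts the bound with
    factor 1/2. So the hypothesis itself rules out identically vanishing coefficients.\<close>
  have "\<exists>k. \<eta> k \<omega> \<noteq> 0"
  proof (rule ccontr)
    assume "\<nexists>k. \<eta> k \<omega> \<noteq> 0"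
    then have "breaks (window (\<lambda>k. \<eta> k \<omega>) m) n = {..<n}" for m n
      by (auto simp: breaks_def window_def)
    with assms(1)[of 1] have "\<forall>\<^sub>F n in sequentially. real n \<le> real n / 2" by simp
    then obtain N where "\<And>n. n \<ge> N \<Longrightarrow> real n \<le> real n / 2" by (auto simp: eventually_sequentially)
    from this[of "Suc N"] show False by simp
  qed
  then obtain k where k: "\<eta> k \<omega> \<noteq> 0" by blast
  show ?thesis
  proof (rule LIMSEQ_I)
    fix e :: real assume "e > 0"
    then obtain i where i: "inverse (real (Suc i)) < e / 3"
      using reals_Archimedean[of "e / 3"] by auto
    from assms(1)[of i] assms(2)[of i] obtain m m' where
      "\<forall>\<^sub>F n in sequentially. real (card (breaks (window (\<lambda>k. \<eta> k \<omega>) m) n)) \<le> inverse (real (Suc i)) * real n"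
      "\<forall>\<^sub>F n in sequentially.
        real (card (breaks (window (\<lambda>k. (-1) ^ k * \<eta> k \<omega>) m') n)) \<le> inverse (real (Suc i)) * real n"
      by blast
    moreover have "\<forall>\<^sub>F n in sequentially. real (2 * m + 2 * m' + k) < e / 3 * real n"
      using \<open>e > 0\<close> by real_asymp
    \<comment> \<open>This gives both \<open>k <= n\<close> and a positive denominator.\<close>
    moreover have "\<forall>\<^sub>F n in sequentially. n \<ge> Suc k" by (rule eventually_ge_at_top)
    ultimately have "\<forall>\<^sub>F n in sequentially. norm (real (num_real_roots (rand_poly \<eta> n \<omega>)) / real n - 0) < e"
    proof eventually_elim
      case (elim n)
      have "real (num_real_roots (rand_poly \<eta> n \<omega>)) \<le> real (2 * m + 2 * m' + k
        + card (breaks (window (\<lambda>k. \<eta> k \<omega>) m) n) + card (breaks (window (\<lambda>k. (-1) ^ k * \<eta> k \<omega>) m') n))"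
        using num_real_roots_le[of \<eta> k \<omega> n m m'] k elim by linarith
      also have "\<dots> < e / 3 * real n + inverse (real (Suc i)) * real n + inverse (real (Suc i)) * real n"
        using elim unfolding of_nat_add by linarith
      also have "\<dots> \<le> e / 3 * real n + e / 3 * real n + e / 3 * real n"
        using i by (intro add_mono mult_right_mono) auto
      also have "\<dots> = e * real n" by simp
      finally show ?case using elim by (simp add: field_simps)
    qed
    then show "\<exists>N. \<forall>n\<ge>N. norm (real (num_real_roots (rand_poly \<eta> n \<omega>)) / real n - 0) < e"
      by (simp add: eventually_sequentially)
  qed
qed

lemma nondegenerate_distr_uminus:
  assumes "real_distribution \<mu>" "nondegenerate \<mu>"
  shows "real_distribution (distr \<mu> borel uminus)" "nondegenerate (distr \<mu> borel uminus)"
proof -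
  interpret real_distribution \<mu> by fact
  show "real_distribution (distr \<mu> borel uminus)" by (rule real_distribution_distr) simp
  have "measure (distr \<mu> borel uminus) {a} = measure \<mu> {-a}" for a
    by (subst measure_distr) (auto intro!: arg_cong[of _ _ "measure \<mu>"])
  then show "nondegenerate (distr \<mu> borel uminus)"
    using assms(2) by (auto simp: nondegenerate_def)
qed

lemma ex_AE_imp_AE_ex: "\<exists>m. AE x in M. Q m x \<Longrightarrow> AE x in M. \<exists>m. Q m x"
  by (auto elim: eventually_mono)

theorem theorem5:
  fixes P :: "'a measure"
    and \<eta> :: "nat \<Rightarrow> 'a \<Rightarrow> real"
    and D :: "real measure set"
    and r :: nat
  assumes "prob_space P"
    and "r \<ge> 1"
    and "finite D" and "card D = r"
    and "\<And>\<mu>. \<mu> \<in> D \<Longrightarrow> real_distribution \<mu> \<and> nondegenerate \<mu>"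
    and "prob_space.indep_vars P (\<lambda>_. borel) \<eta> UNIV"
    and "\<And>k. distr P borel (\<eta> k) \<in> D"
  shows "measure P {\<omega> \<in> space P.
           (\<lambda>n. real (num_real_roots (rand_poly \<eta> n \<omega>)) / real n) \<longlonglongrightarrow> 0} = 1
       \<and> (\<forall>n. integrable P (\<lambda>\<omega>. real (num_real_roots (rand_poly \<eta> n \<omega>))))
       \<and> (\<lambda>n. integral\<^sup>L P (\<lambda>\<omega>. real (num_real_roots (rand_poly \<eta> n \<omega>)))) \<in> o(\<lambda>n. real n)"
proof -
  interpret prob_space P by fact
  let ?M = "\<lambda>n \<omega>. real (num_real_roots (rand_poly \<eta> n \<omega>))"
  have [measurable]: "\<eta> k \<in> borel_measurable P" for k
    using assms(6) by (auto simp: indep_vars_def)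
  \<comment> \<open>The coefficients of the reflected polynomial are still independent, but those of
    odd index have reflected laws; adding these keeps the set finite.\<close>
  define D' where "D' = D \<union> (\<lambda>\<mu>. distr \<mu> borel uminus) ` D"
  have D': "finite D'" "\<And>\<mu>. \<mu> \<in> D' \<Longrightarrow> real_distribution \<mu> \<and> nondegenerate \<mu>"
    using assms(3,5) nondegenerate_distr_uminus by (auto simp: D'_def)
  have "indep_vars (\<lambda>_. borel) (\<lambda>k \<omega>. (-1) ^ k * \<eta> k \<omega>) UNIV"
    by (rule indep_vars_compose2[OF assms(6)]) simp
  moreover have "distr P borel (\<lambda>\<omega>. (-1) ^ k * \<eta> k \<omega>) \<in> D'" for k
  proof (cases "even k")
    case False
    then have "distr P borel (\<lambda>\<omega>. (-1) ^ k * \<eta> k \<omega>) = distr (distr P borel (\<eta> k)) borel uminus"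
      by (subst distr_distr) (simp_all add: comp_def)
    then show ?thesis using assms(7)[of k] by (simp add: D'_def)
  qed (use assms(7) in \<open>simp add: D'_def\<close>)
  ultimately have "\<exists>m. AE \<omega> in P. \<forall>\<^sub>F n in sequentially.
      real (card (breaks (window (\<lambda>k. (-1) ^ k * \<eta> k \<omega>) m) n)) \<le> inverse (real (Suc i)) * real n" for i
    using D' by (intro AE_eventually_breaks_window_le[where D = D']) auto
  then have "AE \<omega> in P. \<exists>m. \<forall>\<^sub>F n in sequentially.
      real (card (breaks (window (\<lambda>k. (-1) ^ k * \<eta> k \<omega>) m) n)) \<le> inverse (real (Suc i)) * real n" for i
    by (rule ex_AE_imp_AE_ex)
  \<comment> \<open>The window length depends on the level \<open>inverse (real (Suc i))\<close>;
    since there are countably many levels, one null set serves all of them.\<close>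
  then have "AE \<omega> in P. \<forall>i. \<exists>m. \<forall>\<^sub>F n in sequentially.
      real (card (breaks (window (\<lambda>k. (-1) ^ k * \<eta> k \<omega>) m) n)) \<le> inverse (real (Suc i)) * real n"
    by (intro AE_all_countable[THEN iffD2] allI)
  moreover have "\<exists>m. AE \<omega> in P. \<forall>\<^sub>F n in sequentially.
      real (card (breaks (window (\<lambda>k. \<eta> k \<omega>) m) n)) \<le> inverse (real (Suc i)) * real n" for i
    using assms(3,5-7) by (intro AE_eventually_breaks_window_le[where D = D]) auto
  then have "AE \<omega> in P. \<exists>m. \<forall>\<^sub>F n in sequentially.
      real (card (breaks (window (\<lambda>k. \<eta> k \<omega>) m) n)) \<le> inverse (real (Suc i)) * real n" for i
    by (rule ex_AE_imp_AE_ex)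
  then have "AE \<omega> in P. \<forall>i. \<exists>m. \<forall>\<^sub>F n in sequentially.
      real (card (breaks (window (\<lambda>k. \<eta> k \<omega>) m) n)) \<le> inverse (real (Suc i)) * real n"
    by (intro AE_all_countable[THEN iffD2] allI)
  ultimately have lim: "AE \<omega> in P. (\<lambda>n. ?M n \<omega> / real n) \<longlonglongrightarrow> 0"
  proof eventually_elim
    case (elim \<omega>)
    show ?case
      by (rule num_real_roots_div_tendsto_0[of \<eta> \<omega>, OF elim(2)[rule_format] elim(1)[rule_format]])
  qed
  have meas [measurable]: "?M n \<in> borel_measurable P" for n
    by (rule measurable_num_real_roots) measurable
  have le: "?M n \<omega> \<le> real n" for n \<omega>
    using num_real_roots_rand_poly_le[of \<eta> n \<omega>] by simp
  have "{\<omega> \<in> space P. (\<lambda>n. ?M n \<omega> / real n) \<longlonglongrightarrow> 0} \<in> sets P"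
    by measurable
  with lim have "\<P>(\<omega> in P. (\<lambda>n. ?M n \<omega> / real n) \<longlonglongrightarrow> 0) = 1"
    by (subst prob_Collect_eq_1)
  moreover have "integrable P (?M n)" for n
    by (rule integrable_const_bound[of _ "real n"]) (use le in auto)
  moreover have "(\<lambda>n. integral\<^sup>L P (?M n)) \<in> o(\<lambda>n. real n)"
  proof (rule smalloI_tendsto)
    have "(\<lambda>n. integral\<^sup>L P (\<lambda>\<omega>. ?M n \<omega> / real n)) \<longlonglongrightarrow> integral\<^sup>L P (\<lambda>_. 0)"
    proof (rule integral_dominated_convergence[where w = "\<lambda>_. 1"])
      \<comment> \<open>At \<open>n = 0\<close> the quotient is 0 by the convention for division by
        zero.\<close>
      show "AE \<omega> in P. norm (?M n \<omega> / real n) \<le> 1" for n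
        using le[of n] by (cases "n = 0") (auto simp: divide_le_eq)
    qed (use lim in auto)
    then show "(\<lambda>n. integral\<^sup>L P (?M n) / real n) \<longlonglongrightarrow> 0" by simp
    show "\<forall>\<^sub>F n in sequentially. real n \<noteq> 0"
      using eventually_gt_at_top[of 0] by eventually_elim simp
  qed
  ultimately show ?thesis by blast
qed

end
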